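(* Consider the delay differential-algebraic equation (DDAE) $$F\bigl(t,\sigma_{-\tau}x,\sigma_{-\tau}\dot x,\dots,\sigma_{-\tau}x^{(\rho)},\dots,\sigma_{\kappa\tau}x,\sigma_{\kappa\tau}\dot x,\dots,\sigma_{\kappa\tau}x^{(\rho)}\bigr)=0 .$$ Differentiation of an equation in this DDAE does not affect the shifting graph of the DDAE.
   Context: Here $F=[F_1,\dots,F_M]$, $x=(x_1,\dots,x_n)$, $\tau>0$, $(\sigma_{k\tau}f)(t)=f(t+k\tau)$, and $\sigma_{k\tau}\xi^{(p)}$ denotes the $p$-th derivative of the component $\xi\in\{x_1,\dots,x_n\}$ shifted by $k\tau$, $k\in\{-1,0,1,\dots,\kappa\}$. Variables are treated as formal symbols, and only the information which variable appears in which scalar equation is used. Differentiation of an equation means that, for some $i\in\{1,\dots,M\}$, the $i$-th equation $F_i$ of the system is replaced by its total derivative $\dot F_i$ with respect to $t$. By the chain rule, the variables regarded as appearing in $\dot F_i$ are the variables $\sigma_{k\tau}\xi^{(p)}$ appearing in $F_i$ together with the corresponding $\sigma_{k\tau}\xi^{(p+1)}$. Shifting graph. Let $\Theta$ be the set of variables $\sigma_{k\tau}\xi^{(p)}$ that appear in at least one equation of the system. Two variables in $\Theta$ are shifting similar if they are of the form $\sigma_{k\tau}\xi^{(p)}$ and $\sigma_{k\tau}\xi^{(q)}$ with the same component $\xi$ and the same shift $k$ (and arbitrary $p,q\in\mathbb N_0$). This is an equivalence relation $R_{\mathrm s}$ on $\Theta$. The shifting graph is the bipartite graph whose vertices are the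 scalar equations on one side and the elements of $\Theta/R_{\mathrm s}$ on the other, with an edge between an equation and an equivalence class if and only if some element of the class appears in the equation. "Does not affect" is understood in the sense that the shifting graphs of the system before and after the differentiation are isomorphic as graphs. *)

theory Defs
  imports "Graph_Theory.Graph_Theory"
begin

text \<open>
  \<^term>\<open>Var j k p\<close> is the formal symbol for the \<open>p\<close>-th derivative of the component \<open>x\<^sub>j\<close>, shifted by
  \<open>k\<tau>\<close>. Since \<open>\<tau> > 0\<close> only labels the shifts (distinct \<open>k\<close> give distinct shifts \<open>k\<tau>\<close>), the
  integer \<open>k\<close> stands for the shift.
\<close>

datatype dvar = Var (component: nat) (shift: int) (order: nat)

text \<open>
  The structure of a DDAE \<open>F = [F\<^sub>1, \<dots>, F\<^sub>M] = 0\<close>: besides its dimensions it records for every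
  equation index \<open>i\<close> the set \<open>vars i\<close> of the variables that appear in \<open>F\<^sub>i\<close>. The explicit time
  argument \<open>t\<close> is not a variable in this sense.
\<close>

record ddae =
  num_eqs :: nat                    \<comment> \<open>\<open>M\<close>\<close>
  num_comps :: nat                  \<comment> \<open>\<open>n\<close>\<close>
  max_shift :: nat                  \<comment> \<open>\<open>\<kappa>\<close>\<close>
  max_order :: nat                  \<comment> \<open>\<open>\<rho>\<close>\<close>
  vars :: "nat \<Rightarrow> dvar set"

definition eqs :: "ddae \<Rightarrow> nat set" where
  "eqs S = {1..num_eqs S}"

text \<open>The arguments that are available to \<open>F\<close> besides \<open>t\<close>.\<close>

definition arguments :: "ddae \<Rightarrow> dvar set" where
  "arguments S = {Var j k p | j k p.
     j \<in> {1..num_comps S} \<and> k \<in> {-1..int (max_shift S)} \<and> p \<le> max_order S}"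

definition is_ddae :: "ddae \<Rightarrow> bool" where
  "is_ddae S \<longleftrightarrow> (\<forall>i\<in>eqs S. vars S i \<subseteq> arguments S)"

fun dot :: "dvar \<Rightarrow> dvar" where
  "dot (Var j k p) = Var j k (Suc p)"

text \<open>
  Replacing \<open>F\<^sub>i\<close> by its total derivative. By the chain rule, the variables regarded as appearing
  in the total derivative are those of \<open>F\<^sub>i\<close> together with their derivatives, so the maximal order
  of the arguments may grow by one.
\<close>

definition differentiate :: "nat \<Rightarrow> ddae \<Rightarrow> ddae" where
  "differentiate i S = S\<lparr>
     max_order := Suc (max_order S),
     vars := (vars S)(i := vars S i \<union> dot ` vars S i)\<rparr>"

lemma is_ddae_differentiate:
  assumes "is_ddae S" "i \<in> eqs S"
  shows "is_ddae (differentiate i S)"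
proof -
  have "v \<in> arguments (differentiate i S)" if "v \<in> arguments S" for v
    using that by (auto simp: arguments_def differentiate_def)
  moreover have "dot v \<in> arguments (differentiate i S)" if "v \<in> arguments S" for v
    using that by (auto simp: arguments_def differentiate_def)
  ultimately show ?thesis
    using assms by (auto simp: is_ddae_def eqs_def differentiate_def subset_iff)
qed

definition appearing :: "ddae \<Rightarrow> dvar set" where  \<comment> \<open>\<open>\<Theta>\<close>\<close>
  "appearing S = (\<Union>i\<in>eqs S. vars S i)"

definition shifting_similar :: "ddae \<Rightarrow> dvar rel" where  \<comment> \<open>\<open>R\<^sub>s\<close>\<close>
  "shifting_similar S = {(v, w) \<in> appearing S \<times> appearing S.
     component v = component w \<and> shift v = shift w}"

lemma equiv_shifting_similar: "equiv (appearing S) (shifting_similar S)"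
  unfolding shifting_similar_def
  by (rule equivI) (auto simp: refl_on_def sym_def trans_def)

text \<open>
  The bipartite, undirected shifting graph; \<open>Inl i\<close> is the equation \<open>F\<^sub>i\<close> and \<open>Inr c\<close> an equivalence
  class. As usual for \<^typ>\<open>'a pair_pre_digraph\<close>, an undirected edge is a pair of opposite arcs.
  Hence \<^const>\<open>digraph_iso\<close> between such graphs is isomorphism of undirected simple graphs.
\<close>

definition shifting_edges :: "ddae \<Rightarrow> (nat \<times> dvar set) set" where
  "shifting_edges S = {(i, c). i \<in> eqs S \<and> c \<in> appearing S // shifting_similar S \<and>
     (\<exists>v\<in>c. v \<in> vars S i)}"

definition shifting_graph :: "ddae \<Rightarrow> (nat + dvar set) pair_pre_digraph" where
  "shifting_graph S = \<lparr>
     pverts = Inl ` eqs S \<union> Inr ` (appearing S // shifting_similar S),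
     parcs = {(Inl i, Inr c) | i c. (i, c) \<in> shifting_edges S} \<union>
             {(Inr c, Inl i) | i c. (i, c) \<in> shifting_edges S}\<rparr>"

lemma pair_bidirected_digraph_shifting_graph: "pair_bidirected_digraph (shifting_graph S)"
  by unfold_locales
    (auto simp: shifting_graph_def shifting_edges_def symmetric_def intro!: symI)

end

theory Submission
  imports Defs
begin

text \<open>
  A class of shifting similar variables is determined by its label, the common component and shift
  of its members, and an equation is joined to a class iff it contains a variable with that label.
  So the shifting graph depends, up to isomorphism, only on the labels occurring in each equation,
  and these do not change when the derivatives of the variables of an equation are added to it.
\<close>

definition label :: "dvar \<Rightarrow> nat \<times> int" where
  "label v = (component v, shift v)"

definition label_class :: "ddae \<Rightarrow> nat \<times> int \<Rightarrow> dvar set" where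
  "label_class S l = {v \<in> appearing S. label v = l}"

lemma label_dot [simp]: "label (dot v) = label v"
  by (cases v) (simp add: label_def)

lemma label_image_appearing: "label ` appearing S = (\<Union>i\<in>eqs S. label ` vars S i)"
  by (simp add: appearing_def image_UN)

text \<open>A label that occurs has a nonempty class, so it can be read back from the class; for
  other labels \<open>label_class\<close> gives the empty set.\<close>

lemma label_image_label_class:
  "l \<in> label ` appearing S \<Longrightarrow> label ` label_class S l = {l}"
  by (auto simp: label_class_def)

lemma quotient_shifting_similar:
  "appearing S // shifting_similar S = label_class S ` label ` appearing S"
proof -
  have "shifting_similar S `` {v} = label_class S (label v)" if "v \<in> appearing S" for v
    using that by (auto simp: shifting_similar_def label_class_def label_def)
  then show ?thesis
    by (auto simp: quotient_def)
qed

text \<open>The class of \<open>l\<close> contains every appearing variable labelled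
  \<open>l\<close>, hence each such variable of equation \<open>i\<close>. Thus the choice of
  representative is immaterial.\<close>

lemma shifting_edges_eq_label_class:
  "shifting_edges S = {(i, label_class S l) | i l. i \<in> eqs S \<and> l \<in> label ` vars S i}"
proof -
  have "(\<exists>v \<in> label_class S l. v \<in> vars S i) \<longleftrightarrow> l \<in> label ` vars S i"
    if "i \<in> eqs S" for i l
    using that by (auto simp: label_class_def appearing_def)
  then show ?thesis
    unfolding shifting_edges_def quotient_shifting_similar label_image_appearing by blast
qed

lemma parcs_shifting_graph:
  "parcs (shifting_graph S) =
    (\<lambda>(i, c). (Inl i, Inr c)) ` shifting_edges S \<union> (\<lambda>(i, c). (Inr c, Inl i)) ` shifting_edges S"
  unfolding shifting_graph_def by auto

text \<open>Arcs are pairs of vertices, so the vertex map alone determines the arc map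
  \<open>map_prod f f\<close>, which commutes with the projections \<open>fst\<close> and
  \<open>snd\<close>.\<close>

lemma digraph_iso_with_projI:
  assumes wf: "wf_digraph (with_proj G)"
    and inj: "inj_on f (pverts G)"
    and verts: "pverts H = f ` pverts G"
    and arcs: "parcs H = map_prod f f ` parcs G"
  shows "digraph_iso (with_proj G) (with_proj H)"
proof -
  let ?h = "\<lparr>iso_verts = f, iso_arcs = map_prod f f, iso_head = snd, iso_tail = fst\<rparr>"
  \<comment> \<open>Well-formedness puts both ends of every arc where \<open>f\<close> is
    injective.\<close>
  have "parcs G \<subseteq> pverts G \<times> pverts G"
    using wf by (force simp: wf_digraph_def)
  moreover have "inj_on (map_prod f f) (pverts G \<times> pverts G)"
    using inj by (rule map_prod_inj_on) (rule inj)
  ultimately have "inj_on (map_prod f f) (parcs G)"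
    by (rule inj_on_subset[rotated])
  then have "pre_digraph.digraph_isomorphism (with_proj G) ?h"
    using wf inj by (auto simp: pre_digraph.digraph_isomorphism_def)
  moreover have "with_proj H = app_iso ?h (with_proj G)"
    by (simp add: app_iso_def with_proj_def verts arcs)
  ultimately show ?thesis
    unfolding digraph_iso_def by blast
qed

text \<open>The isomorphism fixes equations and sends each class of \<open>S\<close> to the class of
  \<open>T\<close> with the same label.\<close>

lemma digraph_iso_shifting_graph:
  assumes eqs: "eqs T = eqs S"
    and labels: "\<And>i. i \<in> eqs S \<Longrightarrow> label ` vars T i = label ` vars S i"
  shows "digraph_iso (with_proj (shifting_graph S)) (with_proj (shifting_graph T))"
proof -
  let ?L = "label ` appearing S"
  \<comment> \<open>Using the label image of \<open>c\<close> avoids choosing a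
    representative.\<close>
  define g where "g c = {w \<in> appearing T. label w \<in> label ` c}" for c
  define f :: "nat + dvar set \<Rightarrow> nat + dvar set" where "f = map_sum id g"
  have L: "label ` appearing T = ?L"
    by (simp add: label_image_appearing eqs labels)
  have g: "g (label_class S l) = label_class T l" if "l \<in> ?L" for l
    unfolding g_def label_image_label_class[OF that] by (simp add: label_class_def)
  \<comment> \<open>By \<open>L\<close>, each label of \<open>S\<close> also occurs in
    \<open>T\<close>, so it can be recovered from its class in \<open>T\<close>.\<close>
  have "inj_on (g \<circ> label_class S) ?L"
    by (rule inj_onI) (metis L comp_apply g label_image_label_class singleton_inject)
  then have inj_g: "inj_on g (label_class S ` ?L)"
    by (rule inj_on_imageI)
  have in_L: "l \<in> ?L" if "i \<in> eqs S" "l \<in> label ` vars S i" for i l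
    using that by (auto simp: label_image_appearing)
  have edges: "shifting_edges T = map_prod id g ` shifting_edges S"
  proof -
    have "map_prod id g ` shifting_edges S =
        {(i, g (label_class S l)) | i l. i \<in> eqs S \<and> l \<in> label ` vars S i}"
      unfolding shifting_edges_eq_label_class by (force simp: image_iff)
    also have "\<dots> = shifting_edges T"
      unfolding shifting_edges_eq_label_class using eqs labels g in_L by (smt (verit) Collect_cong)
    finally show ?thesis ..
  qed
  interpret pair_bidirected_digraph "shifting_graph S"
    by (rule pair_bidirected_digraph_shifting_graph)
  show ?thesis
  proof (rule digraph_iso_with_projI)
    show "wf_digraph (with_proj (shifting_graph S))"
      by (rule wf_digraph)
    show "inj_on f (pverts (shifting_graph S))"
      unfolding f_def shifting_graph_def quotient_shifting_similar
      by (rule inj_onI) (auto dest!: inj_onD[OF inj_g])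
    show "pverts (shifting_graph T) = f ` pverts (shifting_graph S)"
      unfolding f_def shifting_graph_def quotient_shifting_similar L eqs
      by (simp add: image_Un image_image g)
    show "parcs (shifting_graph T) = map_prod f f ` parcs (shifting_graph S)"
      unfolding parcs_shifting_graph edges f_def
      by (simp add: image_Un image_image case_prod_unfold)
  qed
qed

theorem proposition3p8:
  fixes S :: ddae and i :: nat
  assumes "is_ddae S"
    and "i \<in> eqs S"
  shows "digraph_iso (with_proj (shifting_graph S))
                     (with_proj (shifting_graph (differentiate i S)))"
  \<comment> \<open>Since \<open>dot\<close> preserves labels, the added variables contribute no new
    label to equation \<open>i\<close>.\<close>
  by (rule digraph_iso_shifting_graph)
    (auto simp: eqs_def differentiate_def image_Un image_image)

end
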